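(* Let $F$ be a subfield of $\mathbb{R}$, let $q\in F\setminus\{0\}$, and let $f=ax^{2}+bxy+cy^{2}$ with $a,b,c\in F$ be a quadratic form in the quantum plane $\mathcal{O}_q(F^2)$ with $\Delta_q(f)=b^2-4acq<0$. Then $f$ is irreducible in $\mathcal{O}_q(F^2)$. Moreover: (1) If $q\neq\pm1$, then $f$ is not prime in $\mathcal{O}_q(F^2)$. (2) If $q=1$, then $f$ is prime in $\mathcal{O}_q(F^2)$. (3) If $q=-1$, then $f$ is prime in $\mathcal{O}_q(F^2)$ if and only if $b=0$.
   Context: The quantum plane $\mathcal{O}_q(F^2)$ is the $F$-algebra generated by two variables $x,y$ subject to the single relation $yx=qxy$; the elements $x^iy^j$ ($i,j\in\mathbb{N}=\{0,1,2,\dots\}$) form an $F$-basis, and the elements of $\mathcal{O}_q(F^2)$ are called polynomials. Constants are the elements of $F$. A nonzero polynomial is reducible if it equals $gh$ for some nonconstant $g,h\in\mathcal{O}_q(F^2)$; it is irreducible if it is nonconstant and not reducible. In a ring $R$, an element $r$ divides $s$ (written $r\mid s$) if there exists $t\in R$ with $s=rt$ or $s=tr$. An element $r\in R$ is prime if for all $s,t\in R$, $r\mid st$ implies $r\mid s$ or $r\mid t$. *)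

theory Defs
  imports "HOL-Algebra.Algebraic_Closure_Type" "HOL-Library.Poly_Mapping"
begin

text \<open>
  The quantum plane over a subfield \<open>F\<close> of an ambient field, presented on its monomial basis: an
  element is a finitely supported coefficient function, where the key \<open>(i, j)\<close> stands for
  \<open>x\<^sup>i y\<^sup>j\<close>.  Iterating the relation \<open>yx = qxy\<close> gives \<open>y\<^sup>j x\<^sup>k = q\<^bsup>jk\<^esup> x\<^sup>k y\<^sup>j\<close>, whence
  \<open>(x\<^sup>i y\<^sup>j) (x\<^sup>k y\<^sup>l) = q\<^bsup>jk\<^esup> x\<^bsup>i+k\<^esup> y\<^bsup>j+l\<^esup>\<close>.
\<close>

definition qp_mult ::
  "'a::field \<Rightarrow> (nat \<times> nat \<Rightarrow>\<^sub>0 'a) \<Rightarrow> (nat \<times> nat \<Rightarrow>\<^sub>0 'a) \<Rightarrow> (nat \<times> nat \<Rightarrow>\<^sub>0 'a)" where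
  "qp_mult q g h =
     (\<Sum>(i, j) \<in> Poly_Mapping.keys g. \<Sum>(k, l) \<in> Poly_Mapping.keys h.
        Poly_Mapping.single (i + k, j + l)
          (q ^ (j * k) * Poly_Mapping.lookup g (i, j) * Poly_Mapping.lookup h (k, l)))"

definition quantum_plane :: "'a::field set \<Rightarrow> 'a \<Rightarrow> (nat \<times> nat \<Rightarrow>\<^sub>0 'a) ring" where
  "quantum_plane F q =
     \<lparr>carrier = {g. \<forall>m. Poly_Mapping.lookup g m \<in> F},
      monoid.mult = qp_mult q,
      one = Poly_Mapping.single (0, 0) 1,
      ring.zero = 0,
      add = (+)\<rparr>"

definition qp_const :: "'a::field \<Rightarrow> (nat \<times> nat \<Rightarrow>\<^sub>0 'a)" where
  "qp_const c = Poly_Mapping.single (0, 0) c"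

definition qp_x :: "nat \<times> nat \<Rightarrow>\<^sub>0 'a::field" where
  "qp_x = Poly_Mapping.single (1, 0) 1"

definition qp_y :: "nat \<times> nat \<Rightarrow>\<^sub>0 'a::field" where
  "qp_y = Poly_Mapping.single (0, 1) 1"

definition qp_quadratic_form :: "'a::field set \<Rightarrow> 'a \<Rightarrow> 'a \<Rightarrow> 'a \<Rightarrow> 'a \<Rightarrow> (nat \<times> nat \<Rightarrow>\<^sub>0 'a)" where
  "qp_quadratic_form F q a b c =
     (let R = quantum_plane F q in
        qp_const a \<otimes>\<^bsub>R\<^esub> (qp_x [^]\<^bsub>R\<^esub> (2::nat))
        \<oplus>\<^bsub>R\<^esub> qp_const b \<otimes>\<^bsub>R\<^esub> (qp_x \<otimes>\<^bsub>R\<^esub> qp_y)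
        \<oplus>\<^bsub>R\<^esub> qp_const c \<otimes>\<^bsub>R\<^esub> (qp_y [^]\<^bsub>R\<^esub> (2::nat)))"

definition qp_nonconstants :: "'a::field set \<Rightarrow> 'a \<Rightarrow> (nat \<times> nat \<Rightarrow>\<^sub>0 'a) set" where
  "qp_nonconstants F q = carrier (quantum_plane F q) - qp_const ` F"

definition qp_reducible :: "'a::field set \<Rightarrow> 'a \<Rightarrow> (nat \<times> nat \<Rightarrow>\<^sub>0 'a) \<Rightarrow> bool" where
  "qp_reducible F q f \<longleftrightarrow>
     f \<noteq> \<zero>\<^bsub>quantum_plane F q\<^esub> \<and>
     (\<exists>g \<in> qp_nonconstants F q. \<exists>h \<in> qp_nonconstants F q. f = g \<otimes>\<^bsub>quantum_plane F q\<^esub> h)"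

definition qp_irreducible :: "'a::field set \<Rightarrow> 'a \<Rightarrow> (nat \<times> nat \<Rightarrow>\<^sub>0 'a) \<Rightarrow> bool" where
  "qp_irreducible F q f \<longleftrightarrow> f \<in> qp_nonconstants F q \<and> \<not> qp_reducible F q f"

text \<open>
  The library notions of divisibility and primality are meant for commutative rings.  Here
  divisibility is one-sided on an unspecified side, and a prime element may be zero or a unit.
\<close>

definition divides_lr :: "('a, 'b) ring_scheme \<Rightarrow> 'a \<Rightarrow> 'a \<Rightarrow> bool" where
  "divides_lr R r s \<longleftrightarrow> (\<exists>t \<in> carrier R. s = r \<otimes>\<^bsub>R\<^esub> t \<or> s = t \<otimes>\<^bsub>R\<^esub> r)"

definition prime_lr :: "('a, 'b) ring_scheme \<Rightarrow> 'a \<Rightarrow> bool" where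
  "prime_lr R r \<longleftrightarrow>
     r \<in> carrier R \<and>
     (\<forall>s \<in> carrier R. \<forall>t \<in> carrier R.
        divides_lr R r (s \<otimes>\<^bsub>R\<^esub> t) \<longrightarrow> divides_lr R r s \<or> divides_lr R r t)"


text \<open>
  The structure just defined is an \<open>F\<close>-algebra, its generators satisfy \<open>yx = qxy\<close>, and its
  element \<open>single (i, j) c\<close> is indeed \<open>c x\<^sup>i y\<^sup>j\<close>, so that the monomials form an \<open>F\<close>-basis.
\<close>

lemma qp_mult_superset:
  assumes "finite A" "Poly_Mapping.keys g \<subseteq> A" "finite B" "Poly_Mapping.keys h \<subseteq> B"
  shows "qp_mult q g h =
     (\<Sum>(i, j) \<in> A. \<Sum>(k, l) \<in> B.
        Poly_Mapping.single (i + k, j + l)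
          (q ^ (j * k) * Poly_Mapping.lookup g (i, j) * Poly_Mapping.lookup h (k, l)))"
proof -
  have "qp_mult q g h = (\<Sum>(i, j) \<in> A. \<Sum>(k, l) \<in> Poly_Mapping.keys h.
        Poly_Mapping.single (i + k, j + l)
          (q ^ (j * k) * Poly_Mapping.lookup g (i, j) * Poly_Mapping.lookup h (k, l)))"
    unfolding qp_mult_def using assms
    by (intro sum.mono_neutral_left) (auto simp: not_in_keys_iff_lookup_eq_zero case_prod_unfold)
  also have "\<dots> = (\<Sum>(i, j) \<in> A. \<Sum>(k, l) \<in> B.
        Poly_Mapping.single (i + k, j + l)
          (q ^ (j * k) * Poly_Mapping.lookup g (i, j) * Poly_Mapping.lookup h (k, l)))"
    using assms
    by (intro sum.cong refl, clarsimp, intro sum.mono_neutral_left)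
       (auto simp: not_in_keys_iff_lookup_eq_zero)
  finally show ?thesis .
qed

lemma qp_mult_single:
  "qp_mult q (Poly_Mapping.single (i, j) c) (Poly_Mapping.single (k, l) d) =
     Poly_Mapping.single (i + k, j + l) (q ^ (j * k) * c * d)"
  by (subst qp_mult_superset[of "{(i, j)}" _ "{(k, l)}"]) auto

lemma qp_mult_add_left: "qp_mult q (g + g') h = qp_mult q g h + qp_mult q g' h"
  using Poly_Mapping.keys_add[of g g']
  by (simp add: qp_mult_superset[of "Poly_Mapping.keys g \<union> Poly_Mapping.keys g'" _ "Poly_Mapping.keys h"]
      lookup_add algebra_simps single_add sum.distrib case_prod_unfold)

lemma qp_mult_add_right: "qp_mult q g (h + h') = qp_mult q g h + qp_mult q g h'"
  using Poly_Mapping.keys_add[of h h']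
  by (simp add: qp_mult_superset[of "Poly_Mapping.keys g" _ "Poly_Mapping.keys h \<union> Poly_Mapping.keys h'"]
      lookup_add algebra_simps single_add sum.distrib case_prod_unfold)

lemma qp_mult_zero [simp]: "qp_mult q 0 h = 0" "qp_mult q g 0 = 0"
  by (simp_all add: qp_mult_def case_prod_unfold)

lemma qp_additive_induct [case_names single add]:
  fixes g :: "'k \<Rightarrow>\<^sub>0 'a::ab_group_add"
  assumes single: "\<And>m c. P (Poly_Mapping.single m c)"
    and add: "\<And>g h. P g \<Longrightarrow> P h \<Longrightarrow> P (g + h)"
  shows "P g"
proof -
  have "P (\<Sum>m\<in>A. Poly_Mapping.single m (Poly_Mapping.lookup g m))" if "finite A" for A
    using that
  proof induction
    case empty
    show ?case using single[of undefined 0] by simp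
  qed (simp add: single add)
  moreover have "g = (\<Sum>m\<in>Poly_Mapping.keys g. Poly_Mapping.single m (Poly_Mapping.lookup g m))"
    by (rule poly_mapping_eqI)
       (auto simp: lookup_sum lookup_single when_def not_in_keys_iff_lookup_eq_zero)
  ultimately show ?thesis by (metis finite_keys)
qed

lemma qp_mult_assoc: "qp_mult q (qp_mult q f g) h = qp_mult q f (qp_mult q g h)"
proof (induction f rule: qp_additive_induct)
  case (single m c)
  show ?case
  proof (induction g rule: qp_additive_induct)
    case (single m' c')
    show ?case
    proof (induction h rule: qp_additive_induct)
      case (single m'' c'')
      show ?case
        by (cases m; cases m'; cases m'') (simp add: qp_mult_single algebra_simps power_add)
    qed (simp add: qp_mult_add_right)
  qed (simp add: qp_mult_add_left qp_mult_add_right)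
qed (simp add: qp_mult_add_left)

lemma qp_mult_const_left:
  "Poly_Mapping.lookup (qp_mult q (qp_const c) g) m = c * Poly_Mapping.lookup g m"
proof (induction g rule: qp_additive_induct)
  case (single m' d)
  show ?case
    by (cases m') (auto simp: qp_const_def qp_mult_single lookup_single when_def)
qed (simp add: qp_mult_add_right lookup_add algebra_simps)

lemma qp_const_central: "qp_mult q (qp_const c) g = qp_mult q g (qp_const c)"
proof (induction g rule: qp_additive_induct)
  case (single m d)
  show ?case by (cases m) (simp add: qp_const_def qp_mult_single mult.commute)
qed (simp add: qp_mult_add_left qp_mult_add_right)

lemma subfield_type_algebraD:
  fixes F :: "'a::field set"
  assumes "subfield F (ring_of_type_algebra :: 'a ring)"
  shows "0 \<in> F" "1 \<in> F" "u \<in> F \<Longrightarrow> - u \<in> F" "u \<in> F \<Longrightarrow> v \<in> F \<Longrightarrow> u + v \<in> F"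
    "u \<in> F \<Longrightarrow> v \<in> F \<Longrightarrow> u * v \<in> F" "u \<in> F \<Longrightarrow> inverse u \<in> F"
proof -
  let ?K = "ring_of_type_algebra :: 'a ring"
  interpret K: field ?K by (rule field_from_type_algebra)
  note [simp] = ring_of_type_algebra_def
  note sub = subringE[OF subfieldE(1)[OF assms]]
  show *: "0 \<in> F" "1 \<in> F" "u \<in> F \<Longrightarrow> v \<in> F \<Longrightarrow> u + v \<in> F" "u \<in> F \<Longrightarrow> v \<in> F \<Longrightarrow> u * v \<in> F"
    using sub(2,3,6,7) by auto
  show "- u \<in> F" if "u \<in> F"
  proof -
    have "\<ominus>\<^bsub>?K\<^esub> u = - u"
      by (rule K.minus_equality) auto
    then show ?thesis using sub(5)[OF that] by simp
  qed
  show "inverse u \<in> F" if "u \<in> F"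
  proof (cases "u = 0")
    case False
    then have "inv\<^bsub>?K\<^esub> u \<in> F" "u \<otimes>\<^bsub>?K\<^esub> inv\<^bsub>?K\<^esub> u = \<one>\<^bsub>?K\<^esub>"
      using K.subfield_m_inv[OF assms, of u] that by auto
    then show ?thesis using False by (auto simp: inverse_unique)
  qed (use * in auto)
qed

lemma qp_mult_closed:
  fixes F :: "'a::field set"
  assumes F: "subfield F (ring_of_type_algebra :: 'a ring)" and "q \<in> F"
    and g: "\<forall>m. Poly_Mapping.lookup g m \<in> F" and h: "\<forall>m. Poly_Mapping.lookup h m \<in> F"
  shows "Poly_Mapping.lookup (qp_mult q g h) m \<in> F"
proof -
  note cl = subfield_type_algebraD[OF F]
  have sum: "sum u A \<in> F" if "\<And>i. i \<in> A \<Longrightarrow> u i \<in> F" for u :: "nat \<times> nat \<Rightarrow> 'a" and A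
    using that by (induction A rule: infinite_finite_induct) (auto intro: cl)
  have "q ^ n \<in> F" for n
    using \<open>q \<in> F\<close> by (induction n) (auto intro: cl)
  with g h show ?thesis
    by (auto simp: qp_mult_def lookup_sum lookup_single when_def case_prod_unfold intro!: sum cl)
qed

lemma ring_quantum_plane:
  fixes F :: "'a::field set"
  assumes F: "subfield F (ring_of_type_algebra :: 'a ring)" and q: "q \<in> F"
  shows "ring (quantum_plane F q)"
proof (rule ringI)
  note cl = subfield_type_algebraD[OF F]
  show "abelian_group (quantum_plane F q)"
  proof (rule abelian_groupI)
    fix g assume "g \<in> carrier (quantum_plane F q)"
    then show "\<exists>h\<in>carrier (quantum_plane F q). h \<oplus>\<^bsub>quantum_plane F q\<^esub> g = \<zero>\<^bsub>quantum_plane F q\<^esub>"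
      by (intro bexI[of _ "- g"]) (auto simp: quantum_plane_def intro: cl)
  qed (auto simp: quantum_plane_def lookup_add algebra_simps intro: cl)
  have one: "qp_mult q (Poly_Mapping.single (0, 0) 1) g = g" for g
    using qp_mult_const_left[of q 1 g]
    by (auto simp: qp_const_def intro!: poly_mapping_eqI)
  show "Group.monoid (quantum_plane F q)"
    using one qp_const_central[of q 1]
    by (intro Group.monoid.intro)
       (auto simp: quantum_plane_def qp_mult_assoc qp_const_def lookup_single when_def
          intro: cl qp_mult_closed[OF F q])
qed (auto simp: quantum_plane_def qp_mult_add_left qp_mult_add_right)

lemma qp_relation:
  "qp_y \<otimes>\<^bsub>quantum_plane F q\<^esub> qp_x =
     qp_const q \<otimes>\<^bsub>quantum_plane F q\<^esub> (qp_x \<otimes>\<^bsub>quantum_plane F q\<^esub> qp_y)"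
  by (simp add: quantum_plane_def qp_x_def qp_y_def qp_const_def qp_mult_single)

lemma qp_x_power: "qp_x [^]\<^bsub>quantum_plane F q\<^esub> n = Poly_Mapping.single (n, 0) 1" for n :: nat
  by (induction n) (simp_all add: quantum_plane_def nat_pow_def qp_x_def qp_mult_single)

lemma qp_y_power: "qp_y [^]\<^bsub>quantum_plane F q\<^esub> n = Poly_Mapping.single (0, n) 1" for n :: nat
  by (induction n) (simp_all add: quantum_plane_def nat_pow_def qp_y_def qp_mult_single)

lemma qp_monomial:
  fixes i j :: nat
  shows "qp_const c \<otimes>\<^bsub>quantum_plane F q\<^esub>
       (qp_x [^]\<^bsub>quantum_plane F q\<^esub> i \<otimes>\<^bsub>quantum_plane F q\<^esub> qp_y [^]\<^bsub>quantum_plane F q\<^esub> j) =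
     Poly_Mapping.single (i, j) c"
  unfolding qp_x_power qp_y_power by (simp add: quantum_plane_def qp_const_def qp_mult_single)

lemma qp_quadratic_form_eq:
  "qp_quadratic_form F q a b c =
     Poly_Mapping.single (2, 0) a + Poly_Mapping.single (1, 1) b + Poly_Mapping.single (0, 2) c"
  unfolding qp_quadratic_form_def Let_def qp_x_power qp_y_power
  by (simp add: quantum_plane_def qp_const_def qp_x_def qp_y_def qp_mult_single numeral_2_eq_2)

end

theory Submission
  imports Defs
begin

text \<open>
  Irreducibility is a degree argument.  The total degree is additive on nonzero polynomials
  (\<open>total_degree_qp_mult\<close>), so two nonconstant factors of \<open>f\<close> would both have degree one.  If
  \<open>\<alpha>x + \<beta>y\<close> and \<open>\<alpha>'x + \<beta>'y\<close> are their leading forms, then \<open>a = \<alpha>\<alpha>'\<close>, \<open>c = \<beta>\<beta>'\<close> and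
  \<open>b = \<alpha>\<beta>' + q\<beta>\<alpha>'\<close>, which makes \<open>b\<^sup>2 - 4acq\<close> the square of \<open>\<alpha>\<beta>' - q\<beta>\<alpha>'\<close>.

  Moving \<open>x\<close> past \<open>f\<close> rescales \<open>y\<close> by \<open>1/q\<close>: one has \<open>x f = f' x\<close> with
  \<open>f' = ax\<^sup>2 + (b/q)xy + (c/q\<^sup>2)y\<^sup>2\<close>.  Hence \<open>f\<close> divides \<open>f' x\<close>.  By degrees, it cannot divide \<open>x\<close>, and
  it divides \<open>f'\<close> only if \<open>f'\<close> is a constant multiple of \<open>f\<close>; comparing the coefficients of
  \<open>x\<^sup>2\<close>, that means \<open>f' = f\<close>.  As \<open>c \<noteq> 0\<close>, this leaves only \<open>q = 1\<close>, and \<open>q = -1\<close> with \<open>b = 0\<close>; in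
  every other case \<open>f\<close> is not prime (\<open>not_prime_lr_quadratic\<close>).

  In these two cases \<open>f\<close> generates the kernel of a homomorphism to a domain.  Let \<open>\<zeta>\<close> be a
  root of \<open>aqz\<^sup>2 + bz + c\<close>, which is not real because the discriminant is negative, and let \<open>\<sigma>\<close> be
  the identity if \<open>q = 1\<close> and complex conjugation if \<open>q = -1\<close>.  Then \<open>\<sigma>\<zeta> = q\<zeta>\<close> (in the second case
  \<open>b = 0\<close> makes \<open>\<zeta>\<close> purely imaginary), so that \<open>x \<mapsto> \<zeta>y\<close>, \<open>y \<mapsto> y\<close> respects \<open>yx = qxy\<close> and defines a
  homomorphism to the skew polynomial ring \<open>\<complex>[y; \<sigma>]\<close>, in which \<open>yz = \<sigma>(z)y\<close>.  It sends \<open>f\<close> to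
  \<open>(aqz\<^sup>2 + bz + c)y\<^sup>2\<close> evaluated at \<open>z = \<zeta>\<close>, that is, to \<open>0\<close>.  Conversely, dividing by \<open>f\<close> with respect
  to \<open>x\<close> leaves a remainder that is linear in \<open>x\<close>, and a linear remainder with real coefficients
  is killed only if it vanishes, because \<open>\<zeta>\<close> is not real.  So \<open>f\<close> divides exactly the elements of the
  kernel, and \<open>\<complex>[y; \<sigma>]\<close> has no zero divisors (\<open>skew_coeff_mult_nonzero\<close>).
\<close>

section \<open>The total degree\<close>

lemma lookup_qp_mult:
  "Poly_Mapping.lookup (qp_mult q g h) (m, n) =
     (\<Sum>i\<le>m. \<Sum>j\<le>n. q ^ (j * (m - i)) * Poly_Mapping.lookup g (i, j) * Poly_Mapping.lookup h (m - i, n - j))"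
proof (induction g rule: qp_additive_induct)
  case (single m1 c)
  show ?case
  proof (induction h rule: qp_additive_induct)
    case (single m2 d)
    obtain i' j' k l where m: "m1 = (i', j')" "m2 = (k, l)" by fastforce
    have "q ^ (j * (m - i)) * Poly_Mapping.lookup (Poly_Mapping.single m1 c) (i, j) *
            Poly_Mapping.lookup (Poly_Mapping.single m2 d) (m - i, n - j) =
          (if j = j' then (if i = i' then
             q ^ (j' * (m - i')) * c * (if m - i' = k \<and> n - j' = l then d else 0) else 0) else 0)" for i j
      by (auto simp: m lookup_single when_def)
    then have "(\<Sum>i\<le>m. \<Sum>j\<le>n. q ^ (j * (m - i)) * Poly_Mapping.lookup (Poly_Mapping.single m1 c) (i, j) *
            Poly_Mapping.lookup (Poly_Mapping.single m2 d) (m - i, n - j)) =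
          (\<Sum>i\<le>m. \<Sum>j\<le>n. if j = j' then (if i = i' then
             q ^ (j' * (m - i')) * c * (if m - i' = k \<and> n - j' = l then d else 0) else 0) else 0)"
      by simp
    also have "\<dots> = (if m = i' + k \<and> n = j' + l then q ^ (j' * k) * c * d else 0)"
      by (cases "j' \<le> n") auto
    finally show ?case
      by (auto simp: m qp_mult_single lookup_single when_def)
  qed (simp add: qp_mult_add_right lookup_add algebra_simps sum.distrib)
qed (simp add: qp_mult_add_left lookup_add algebra_simps sum.distrib)

text \<open>
  The degree of \<open>0\<close> is the unspecified maximum of the empty set.
\<close>

definition total_degree :: "(nat \<times> nat \<Rightarrow>\<^sub>0 'a::zero) \<Rightarrow> nat" where
  "total_degree g = Max ((\<lambda>(i, j). i + j) ` Poly_Mapping.keys g)"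

lemma le_total_degree: "Poly_Mapping.lookup g (i, j) \<noteq> 0 \<Longrightarrow> i + j \<le> total_degree g"
  unfolding total_degree_def by (intro Max_ge) (force simp: in_keys_iff)+

lemma lookup_above_total_degree: "total_degree g < i + j \<Longrightarrow> Poly_Mapping.lookup g (i, j) = 0"
  using le_total_degree[of g i j] by fastforce

lemma total_degree_eqI:
  assumes "Poly_Mapping.lookup g (i, j) \<noteq> 0" "i + j = d"
    and "\<And>k l. Poly_Mapping.lookup g (k, l) \<noteq> 0 \<Longrightarrow> k + l \<le> d"
  shows "total_degree g = d"
  unfolding total_degree_def using assms
  by (intro Max_eqI) (force simp: in_keys_iff)+

text \<open>
  Total degree alone does not single out one monomial.  Breaking ties by the exponent of \<open>x\<close> does,
  and this order is compatible with adding exponents, so leading monomials multiply.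
\<close>

lemma leading_monomial_exists:
  assumes "g \<noteq> 0"
  obtains i j where "Poly_Mapping.lookup g (i, j) \<noteq> 0" "i + j = total_degree g"
    and "\<And>k l. Poly_Mapping.lookup g (k, l) \<noteq> 0 \<Longrightarrow> k + l = total_degree g \<Longrightarrow> k \<le> i"
proof -
  define I where "I = {i. \<exists>j. i + j = total_degree g \<and> Poly_Mapping.lookup g (i, j) \<noteq> 0}"
  have "Poly_Mapping.keys g \<noteq> {}" using assms by simp
  then have "total_degree g \<in> (\<lambda>(i, j). i + j) ` Poly_Mapping.keys g"
    unfolding total_degree_def by (intro Max_in) auto
  then have "I \<noteq> {}" by (force simp: I_def in_keys_iff)
  moreover have "finite I" by (rule finite_subset[of _ "{..total_degree g}"]) (auto simp: I_def)
  ultimately have "Max I \<in> I" "\<And>k. k \<in> I \<Longrightarrow> k \<le> Max I" by auto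
  then show thesis using that unfolding I_def by blast
qed

text \<open>
  At the sum of the two leading exponents only one pair of monomials contributes, and its
  contribution is the product of the leading coefficients and a power of \<open>q\<close>.
\<close>

lemma total_degree_qp_mult:
  fixes g h :: "nat \<times> nat \<Rightarrow>\<^sub>0 'a::field"
  assumes "q \<noteq> 0" "g \<noteq> 0" "h \<noteq> 0"
  shows "total_degree (qp_mult q g h) = total_degree g + total_degree h"
proof -
  obtain i j where ij: "Poly_Mapping.lookup g (i, j) \<noteq> 0" "i + j = total_degree g"
    "\<And>k l. Poly_Mapping.lookup g (k, l) \<noteq> 0 \<Longrightarrow> k + l = total_degree g \<Longrightarrow> k \<le> i"
    using leading_monomial_exists[OF assms(2)] by metis
  obtain k l where kl: "Poly_Mapping.lookup h (k, l) \<noteq> 0" "k + l = total_degree h"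
    "\<And>i j. Poly_Mapping.lookup h (i, j) \<noteq> 0 \<Longrightarrow> i + j = total_degree h \<Longrightarrow> i \<le> k"
    using leading_monomial_exists[OF assms(3)] by metis
  have only: "i' = i \<and> j' = j"
    if "i' \<le> i + k" "j' \<le> j + l" "Poly_Mapping.lookup g (i', j') \<noteq> 0"
      "Poly_Mapping.lookup h (i + k - i', j + l - j') \<noteq> 0" for i' j'
  proof -
    have "i' + j' \<le> i + j" "(i + k - i') + (j + l - j') \<le> k + l"
      using le_total_degree that ij(2) kl(2) by metis+
    with that have "i' + j' = i + j" "(i + k - i') + (j + l - j') = k + l" by linarith+
    moreover from this have "i' \<le> i" "i + k - i' \<le> k"
      using ij kl that by metis+
    ultimately show ?thesis using that by linarith
  qed
  have summand: "q ^ (j' * (i + k - i')) * Poly_Mapping.lookup g (i', j') * Poly_Mapping.lookup h (i + k - i', j + l - j') =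
      (if j' = j then if i' = i then
         q ^ (j * k) * Poly_Mapping.lookup g (i, j) * Poly_Mapping.lookup h (k, l) else 0 else 0)"
    if "i' \<le> i + k" "j' \<le> j + l" for i' j'
  proof (cases "i' = i \<and> j' = j")
    case False
    then show ?thesis using only[OF that] by (metis mult_eq_0_iff)
  qed simp
  have "Poly_Mapping.lookup (qp_mult q g h) (i + k, j + l) =
      (\<Sum>i'\<le>i + k. \<Sum>j'\<le>j + l. if j' = j then if i' = i then
         q ^ (j * k) * Poly_Mapping.lookup g (i, j) * Poly_Mapping.lookup h (k, l) else 0 else 0)"
    unfolding lookup_qp_mult by (intro sum.cong refl summand) simp_all
  then have "Poly_Mapping.lookup (qp_mult q g h) (i + k, j + l) \<noteq> 0"
    using assms(1) ij(1) kl(1) by simp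
  moreover have "m + n \<le> total_degree g + total_degree h"
    if "Poly_Mapping.lookup (qp_mult q g h) (m, n) \<noteq> 0" for m n
  proof -
    from that obtain i' j' where "i' \<le> m" "j' \<le> n" "Poly_Mapping.lookup g (i', j') \<noteq> 0"
        "Poly_Mapping.lookup h (m - i', n - j') \<noteq> 0"
      unfolding lookup_qp_mult by (auto elim!: sum.not_neutral_contains_not_neutral)
    then have "i' + j' \<le> total_degree g" "(m - i') + (n - j') \<le> total_degree h"
      using le_total_degree by blast+
    then show ?thesis using \<open>i' \<le> m\<close> \<open>j' \<le> n\<close> by linarith
  qed
  ultimately show ?thesis using ij(2) kl(2) by (intro total_degree_eqI[of _ "i + k" "j + l"]) auto
qed

lemma total_degree_0_imp_qp_const:
  assumes "total_degree g = 0"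
  shows "g = qp_const (Poly_Mapping.lookup g (0, 0))"
proof (rule poly_mapping_eqI)
  fix m :: "nat \<times> nat"
  show "Poly_Mapping.lookup g m = Poly_Mapping.lookup (qp_const (Poly_Mapping.lookup g (0, 0))) m"
    using lookup_above_total_degree[of g "fst m" "snd m"] assms
    by (cases m) (auto simp: qp_const_def lookup_single when_def)
qed

section \<open>Irreducibility of quadratic forms\<close>

definition quadratic :: "'a::field \<Rightarrow> 'a \<Rightarrow> 'a \<Rightarrow> (nat \<times> nat \<Rightarrow>\<^sub>0 'a)" where
  "quadratic a b c =
     Poly_Mapping.single (2, 0) a + Poly_Mapping.single (1, 1) b + Poly_Mapping.single (0, 2) c"

lemma lookup_quadratic:
  "Poly_Mapping.lookup (quadratic a b c) m =
     (if m = (2, 0) then a else if m = (1, 1) then b else if m = (0, 2) then c else 0)"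
  by (auto simp: quadratic_def lookup_add lookup_single when_def)

lemma total_degree_quadratic: "a \<noteq> 0 \<Longrightarrow> total_degree (quadratic a b c) = 2"
  by (rule total_degree_eqI[of _ 2 0]) (auto simp: lookup_quadratic split: if_splits)

text \<open>
  Only the leading forms of \<open>g\<close> and \<open>h\<close> matter, and for them the identity reads
  \<open>(\<alpha>\<beta>' + q\<beta>\<alpha>')\<^sup>2 - 4q \<alpha>\<alpha>' \<beta>\<beta>' = (\<alpha>\<beta>' - q\<beta>\<alpha>')\<^sup>2\<close>.
\<close>

lemma discriminant_of_product:
  fixes g h :: "nat \<times> nat \<Rightarrow>\<^sub>0 'a::field"
  assumes gh: "quadratic a b c = qp_mult q g h" and "total_degree g = 1" "total_degree h = 1"
  shows "b\<^sup>2 - 4 * a * c * q =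
    (Poly_Mapping.lookup g (1, 0) * Poly_Mapping.lookup h (0, 1) -
       q * Poly_Mapping.lookup g (0, 1) * Poly_Mapping.lookup h (1, 0))\<^sup>2"
proof -
  have g: "Poly_Mapping.lookup g (i, j) = 0" "Poly_Mapping.lookup h (i, j) = 0" if "1 < i + j" for i j
    using that assms lookup_above_total_degree by metis+
  have "a = Poly_Mapping.lookup (qp_mult q g h) (2, 0)" "b = Poly_Mapping.lookup (qp_mult q g h) (1, 1)"
    "c = Poly_Mapping.lookup (qp_mult q g h) (0, 2)"
    by (simp_all add: gh[symmetric] lookup_quadratic)
  then have "a = Poly_Mapping.lookup g (1, 0) * Poly_Mapping.lookup h (1, 0)"
    "b = Poly_Mapping.lookup g (1, 0) * Poly_Mapping.lookup h (0, 1) +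
       q * Poly_Mapping.lookup g (0, 1) * Poly_Mapping.lookup h (1, 0)"
    "c = Poly_Mapping.lookup g (0, 1) * Poly_Mapping.lookup h (0, 1)"
    unfolding lookup_qp_mult by (simp_all add: g numeral_2_eq_2)
  then show ?thesis by (simp add: power2_eq_square algebra_simps)
qed

lemma qp_irreducible_quadratic:
  fixes a b c q :: real
  assumes "0 \<in> F" "q \<noteq> 0" and coeffs: "a \<in> F" "b \<in> F" "c \<in> F" and disc: "b\<^sup>2 - 4 * a * c * q < 0"
  shows "qp_irreducible F q (quadratic a b c)"
proof -
  have "a \<noteq> 0" using disc by (auto simp: power2_eq_square not_less)
  then have deg: "total_degree (quadratic a b c) = 2" by (rule total_degree_quadratic)
  have "quadratic a b c \<noteq> qp_const d" for d
    using \<open>a \<noteq> 0\<close> lookup_quadratic[of a b c "(2, 0)"] by (auto simp: qp_const_def lookup_single)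
  then have "quadratic a b c \<in> qp_nonconstants F q"
    using assms(1) coeffs by (auto simp: qp_nonconstants_def quantum_plane_def lookup_quadratic)
  moreover have "quadratic a b c \<noteq> qp_mult q g h"
    if g: "g \<in> qp_nonconstants F q" and h: "h \<in> qp_nonconstants F q" for g h
  proof
    assume gh: "quadratic a b c = qp_mult q g h"
    have nonconst: "u \<noteq> 0 \<and> total_degree u \<noteq> 0" if "u \<in> qp_nonconstants F q" for u
    proof -
      have "u \<noteq> qp_const 0" "u \<noteq> qp_const (Poly_Mapping.lookup u (0, 0))"
        using that \<open>0 \<in> F\<close> by (auto simp: qp_nonconstants_def quantum_plane_def)
      then show ?thesis using total_degree_0_imp_qp_const[of u] by (auto simp: qp_const_def)
    qed
    then have "total_degree g + total_degree h = 2"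
      using total_degree_qp_mult[of q g h] deg gh g h \<open>q \<noteq> 0\<close> by metis
    then have "total_degree g = 1" "total_degree h = 1"
      using nonconst[OF g] nonconst[OF h] by linarith+
    from discriminant_of_product[OF gh this] disc show False
      by (metis not_less zero_le_power2)
  qed
  ultimately show ?thesis
    by (auto simp: qp_irreducible_def qp_reducible_def quantum_plane_def)
qed

section \<open>Quadratic forms that are not prime\<close>

lemma qp_x_commutes_past_quadratic:
  assumes "q \<noteq> 0"
  shows "qp_mult q qp_x (quadratic a b c) = qp_mult q (quadratic a (b / q) (c / q\<^sup>2)) qp_x"
  using assms by (simp add: quadratic_def qp_x_def qp_mult_add_left qp_mult_add_right qp_mult_single
      numeral_2_eq_2 numeral_3_eq_3)

lemma divides_lr_imp_total_degree:
  assumes "divides_lr (quantum_plane F q) f g" "q \<noteq> 0" "f \<noteq> 0" "g \<noteq> 0"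
  obtains t where "g = qp_mult q f t \<or> g = qp_mult q t f" "total_degree g = total_degree f + total_degree t"
proof -
  from assms(1) obtain t where t: "g = qp_mult q f t \<or> g = qp_mult q t f"
    by (auto simp: divides_lr_def quantum_plane_def)
  with assms(4) have "t \<noteq> 0" by auto
  with t total_degree_qp_mult[of q f t] total_degree_qp_mult[of q t f] assms
  show thesis by (intro that[of t]) auto
qed

text \<open>
  The hypothesis on \<open>b / q\<close> and \<open>c / q\<^sup>2\<close> says that \<open>f\<close> does not commute with \<open>x\<close>; the witness against
  primality is the product \<open>f' x = x f\<close>.
\<close>

lemma not_prime_lr_quadratic:
  fixes F :: "real set"
  assumes F: "subfield F (ring_of_type_algebra :: real ring)"
    and q: "q \<in> F" "q \<noteq> 0" and coeffs: "a \<in> F" "b \<in> F" "c \<in> F" and "a \<noteq> 0"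
    and twist: "b / q \<noteq> b \<or> c / q\<^sup>2 \<noteq> c"
  shows "\<not> prime_lr (quantum_plane F q) (quadratic a b c)"
proof
  let ?R = "quantum_plane F q" and ?f = "quadratic a b c" and ?f' = "quadratic a (b / q) (c / q\<^sup>2)"
  assume prime: "prime_lr ?R ?f"
  note cl = subfield_type_algebraD[OF F]
  have F': "b / q \<in> F" "c / q\<^sup>2 \<in> F"
    using cl(5,6) q coeffs by (auto simp: divide_inverse power2_eq_square)
  have f: "?f \<noteq> 0" "?f' \<noteq> 0" "qp_x \<noteq> (0 :: nat \<times> nat \<Rightarrow>\<^sub>0 real)"
    using lookup_quadratic[of a b c "(2, 0)"] lookup_quadratic[of a "b / q" "c / q\<^sup>2" "(2, 0)"] \<open>a \<noteq> 0\<close>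
    by (auto simp: qp_x_def) (metis lookup_single_eq lookup_zero zero_neq_one)
  have deg: "total_degree ?f = 2" "total_degree ?f' = 2" "total_degree (qp_x :: nat \<times> nat \<Rightarrow>\<^sub>0 real) = 1"
    using \<open>a \<noteq> 0\<close>
    by (simp_all add: total_degree_quadratic)
       (rule total_degree_eqI[of _ 1 0], auto simp: qp_x_def lookup_single when_def split: if_splits)
  have carrier: "?f' \<in> carrier ?R" "qp_x \<in> carrier ?R"
    using cl(1,2) coeffs F' by (auto simp: quantum_plane_def lookup_quadratic qp_x_def lookup_single
        when_def)
  have "divides_lr ?R ?f (?f' \<otimes>\<^bsub>?R\<^esub> qp_x)"
    unfolding divides_lr_def using carrier(2) qp_x_commutes_past_quadratic[OF q(2), of a b c]
    by (intro bexI[of _ qp_x]) (simp_all add: quantum_plane_def)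
  with prime carrier have "divides_lr ?R ?f ?f' \<or> divides_lr ?R ?f qp_x"
    by (auto simp: prime_lr_def)
  then show False
  proof
    assume "divides_lr ?R ?f qp_x"
    then show False
      using deg by (elim divides_lr_imp_total_degree[OF _ q(2) f(1,3)]) simp
  next
    assume "divides_lr ?R ?f ?f'"
    then obtain t where t: "?f' = qp_mult q ?f t \<or> ?f' = qp_mult q t ?f" "total_degree t = 0"
      using deg by (elim divides_lr_imp_total_degree[OF _ q(2) f(1,2)]) auto
    from total_degree_0_imp_qp_const[OF t(2)] obtain d where "t = qp_const d" ..
    with t(1) have eq: "?f' = qp_mult q (qp_const d) ?f" by (metis qp_const_central)
    have "Poly_Mapping.lookup ?f' m = d * Poly_Mapping.lookup ?f m" for m
      unfolding eq by (rule qp_mult_const_left)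
    from this[of "(2, 0)"] this[of "(1, 1)"] this[of "(0, 2)"] twist \<open>a \<noteq> 0\<close>
    show False by (auto simp: lookup_quadratic)
  qed
qed

section \<open>Specialization to a skew polynomial ring\<close>

text \<open>
  The coefficient of \<open>y\<^sup>n\<close> in the image of \<open>g\<close> under \<open>x \<mapsto> \<zeta>y\<close>, \<open>y \<mapsto> y\<close>.  In a ring where
  \<open>y\<zeta> = q\<zeta>y\<close>, the power \<open>(\<zeta>y)\<^sup>i\<close> equals \<open>q\<^bsup>0 + 1 + \<dots> + (i - 1)\<^esup> \<zeta>\<^sup>i y\<^sup>i\<close>, whence the binomial coefficient in
  the exponent.  The sequence of these coefficients stands for the skew polynomial itself.
\<close>

definition skew_coeff :: "real \<Rightarrow> complex \<Rightarrow> (nat \<times> nat \<Rightarrow>\<^sub>0 real) \<Rightarrow> nat \<Rightarrow> complex" where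
  "skew_coeff q \<zeta> g n =
     (\<Sum>i\<le>n. complex_of_real (Poly_Mapping.lookup g (i, n - i) * q ^ (i choose 2)) * \<zeta> ^ i)"

lemma skew_coeff_add: "skew_coeff q \<zeta> (g + h) n = skew_coeff q \<zeta> g n + skew_coeff q \<zeta> h n"
  by (simp add: skew_coeff_def lookup_add algebra_simps sum.distrib)

lemma skew_coeff_single:
  "skew_coeff q \<zeta> (Poly_Mapping.single (i, j) d) n =
     (if n = i + j then complex_of_real (d * q ^ (i choose 2)) * \<zeta> ^ i else 0)"
proof -
  have "skew_coeff q \<zeta> (Poly_Mapping.single (i, j) d) n =
     (\<Sum>k\<le>n. if k = i then (if n = i + j then complex_of_real (d * q ^ (i choose 2)) * \<zeta> ^ i else 0) else 0)"
    unfolding skew_coeff_def by (intro sum.cong refl) (auto simp: lookup_single when_def)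
  then show ?thesis by auto
qed

lemma choose_two_add: "(i + k) choose 2 = (i choose 2) + (k choose 2) + i * k"
  by (induction i) (auto simp: numeral_2_eq_2)

text \<open>
  The conditions under which \<open>x \<mapsto> \<zeta>y\<close>, \<open>y \<mapsto> y\<close> extends to a homomorphism from the quantum plane to
  \<open>\<complex>[y; \<sigma>]\<close>: the last one is the relation \<open>yx = qxy\<close> read in that ring.
\<close>

locale skew_specialization =
  fixes q :: real and \<zeta> :: complex and \<sigma> :: "complex \<Rightarrow> complex"
  assumes \<sigma>_add: "\<sigma> (u + v) = \<sigma> u + \<sigma> v"
    and \<sigma>_mult: "\<sigma> (u * v) = \<sigma> u * \<sigma> v"
    and \<sigma>_real: "\<sigma> (complex_of_real r) = complex_of_real r"
    and \<sigma>_nonzero: "u \<noteq> 0 \<Longrightarrow> \<sigma> u \<noteq> 0"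
    and \<sigma>_\<zeta>: "\<sigma> \<zeta> = complex_of_real q * \<zeta>"
begin

lemma iterate_add: "(\<sigma> ^^ n) (u + v) = (\<sigma> ^^ n) u + (\<sigma> ^^ n) v"
  by (induction n) (simp_all add: \<sigma>_add)

lemma iterate_mult: "(\<sigma> ^^ n) (u * v) = (\<sigma> ^^ n) u * (\<sigma> ^^ n) v"
  by (induction n) (simp_all add: \<sigma>_mult)

lemma iterate_real: "(\<sigma> ^^ n) (complex_of_real r) = complex_of_real r"
  by (induction n) (simp_all add: \<sigma>_real)

lemma iterate_nonzero: "u \<noteq> 0 \<Longrightarrow> (\<sigma> ^^ n) u \<noteq> 0"
  by (induction n) (simp_all add: \<sigma>_nonzero)

lemma iterate_0: "(\<sigma> ^^ n) 0 = 0"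
  using iterate_real[of n 0] by simp

lemma iterate_\<zeta>_power: "(\<sigma> ^^ n) (\<zeta> ^ k) = complex_of_real (q ^ (n * k)) * \<zeta> ^ k"
proof -
  have \<zeta>: "(\<sigma> ^^ n) \<zeta> = complex_of_real (q ^ n) * \<zeta>"
    by (induction n) (simp_all add: \<sigma>_mult \<sigma>_\<zeta> \<sigma>_real del: of_real_power)
  show ?thesis
  proof (induction k)
    case 0
    show ?case using iterate_real[of n 1] by simp
  next
    case (Suc k)
    then show ?case by (simp add: iterate_mult \<zeta> power_add)
  qed
qed

text \<open>
  The right-hand side is multiplication in \<open>\<complex>[y; \<sigma>]\<close>, where \<open>y\<^sup>k z = \<sigma>\<^sup>k(z) y\<^sup>k\<close>.  On monomials the powers
  of \<open>q\<close> agree by \<open>choose_two_add\<close>: the factor \<open>q\<^bsup>jk\<^esup>\<close> comes from the quantum plane and the factor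
  \<open>q\<^bsup>ik\<^esup>\<close> from the binomial coefficient, and \<open>\<sigma>\<^bsup>i+j\<^esup>\<close> multiplies \<open>\<zeta>\<^sup>k\<close> by both.
\<close>

lemma skew_coeff_mult:
  "skew_coeff q \<zeta> (qp_mult q g h) n =
     (\<Sum>k\<le>n. skew_coeff q \<zeta> g k * (\<sigma> ^^ k) (skew_coeff q \<zeta> h (n - k)))"
proof (induction g rule: qp_additive_induct)
  case (single m1 c)
  show ?case
  proof (induction h rule: qp_additive_induct)
    case (single m2 d)
    obtain i j k l where m: "m1 = (i, j)" "m2 = (k, l)" by fastforce
    have "(\<Sum>p\<le>n. skew_coeff q \<zeta> (Poly_Mapping.single m1 c) p *
            (\<sigma> ^^ p) (skew_coeff q \<zeta> (Poly_Mapping.single m2 d) (n - p))) =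
          (\<Sum>p\<le>n. if p = i + j then (if n - p = k + l then
             complex_of_real (c * q ^ (i choose 2)) * \<zeta> ^ i *
               (complex_of_real (d * q ^ (k choose 2)) * (complex_of_real (q ^ ((i + j) * k)) * \<zeta> ^ k)) else 0) else 0)"
      unfolding m skew_coeff_single
      by (intro sum.cong refl)
         (auto simp: iterate_0 iterate_mult iterate_real iterate_\<zeta>_power simp del: of_real_power of_real_mult)
    also have "\<dots> = (if n = i + j + (k + l) then
             complex_of_real (c * q ^ (i choose 2)) * \<zeta> ^ i *
               (complex_of_real (d * q ^ (k choose 2)) * (complex_of_real (q ^ ((i + j) * k)) * \<zeta> ^ k)) else 0)"
      by auto
    finally show ?case
      by (auto simp: m qp_mult_single skew_coeff_single choose_two_add power_add algebra_simps)
  qed (simp add: qp_mult_add_right skew_coeff_add iterate_add distrib_left sum.distrib)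
qed (simp add: qp_mult_add_left skew_coeff_add distrib_right sum.distrib)

text \<open>
  The terms of lowest degree multiply to a nonzero term, since \<open>\<sigma>\<close> sends nonzero numbers to nonzero
  numbers.
\<close>

lemma skew_coeff_mult_nonzero:
  assumes "skew_coeff q \<zeta> s k \<noteq> 0" "skew_coeff q \<zeta> t l \<noteq> 0"
  shows "\<exists>n. skew_coeff q \<zeta> (qp_mult q s t) n \<noteq> 0"
proof -
  define k' where "k' = (LEAST k. skew_coeff q \<zeta> s k \<noteq> 0)"
  define l' where "l' = (LEAST l. skew_coeff q \<zeta> t l \<noteq> 0)"
  have k': "skew_coeff q \<zeta> s k' \<noteq> 0" "\<And>k. k < k' \<Longrightarrow> skew_coeff q \<zeta> s k = 0"
    unfolding k'_def using assms(1) by (rule LeastI) (use not_less_Least in blast)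
  have l': "skew_coeff q \<zeta> t l' \<noteq> 0" "\<And>l. l < l' \<Longrightarrow> skew_coeff q \<zeta> t l = 0"
    unfolding l'_def using assms(2) by (rule LeastI) (use not_less_Least in blast)
  have "skew_coeff q \<zeta> (qp_mult q s t) (k' + l') =
     (\<Sum>k\<le>k' + l'. if k = k' then skew_coeff q \<zeta> s k' * (\<sigma> ^^ k') (skew_coeff q \<zeta> t l') else 0)"
    unfolding skew_coeff_mult
  proof (intro sum.cong refl)
    fix k assume "k \<in> {..k' + l'}"
    consider "k < k'" | "k = k'" | "k > k'" by linarith
    then show "skew_coeff q \<zeta> s k * (\<sigma> ^^ k) (skew_coeff q \<zeta> t (k' + l' - k)) =
        (if k = k' then skew_coeff q \<zeta> s k' * (\<sigma> ^^ k') (skew_coeff q \<zeta> t l') else 0)"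
    proof cases
      case 3
      then have "k' + l' - k < l'" using \<open>k \<in> {..k' + l'}\<close> by auto
      with 3 show ?thesis by (simp add: l'(2) iterate_0)
    qed (simp_all add: k'(2))
  qed
  then have "skew_coeff q \<zeta> (qp_mult q s t) (k' + l') \<noteq> 0"
    using k'(1) l'(1) iterate_nonzero by simp
  then show ?thesis ..
qed

end

lemma skew_coeff_quadratic:
  assumes "complex_of_real (a * q) * \<zeta>\<^sup>2 + complex_of_real b * \<zeta> + complex_of_real c = 0"
  shows "skew_coeff q \<zeta> (quadratic a b c) n = 0"
  using assms by (simp add: quadratic_def skew_coeff_add skew_coeff_single) (simp add: numeral_2_eq_2)

section \<open>The kernel of the specialization\<close>

text \<open>
  The coefficient of \<open>x\<^sup>2\<close> is invertible, so a monomial \<open>dx\<^bsup>k+2\<^esup>y\<^sup>j\<close> can be replaced, up to a multiple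
  of the form, by monomials in which the exponent of \<open>x\<close> is smaller.
\<close>

lemma x_degree_le_1_division:
  fixes F :: "real set"
  assumes F: "subfield F (ring_of_type_algebra :: real ring)" and q: "q \<in> F"
    and coeffs: "a \<in> F" "b \<in> F" "c \<in> F" and a: "a \<noteq> 0"
    and g: "g \<in> carrier (quantum_plane F q)"
  obtains h r where "h \<in> carrier (quantum_plane F q)" "g = qp_mult q (quadratic a b c) h + r"
    "\<And>i j. 1 < i \<Longrightarrow> Poly_Mapping.lookup r (i, j) = 0"
proof -
  let ?f = "quadratic a b c"
  define P where "P g \<longleftrightarrow> (\<exists>h r. h \<in> carrier (quantum_plane F q) \<and> g = qp_mult q ?f h + r \<and>
     (\<forall>i j. 1 < i \<longrightarrow> Poly_Mapping.lookup r (i, j) = 0))" for g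
  note cl = subfield_type_algebraD[OF F]
  have pow: "q ^ n \<in> F" for n using q by (induction n) (auto intro: cl)
  have add: "P (g + g')" if "P g" "P g'" for g g'
  proof -
    from that obtain h r h' r' where "h \<in> carrier (quantum_plane F q)" "h' \<in> carrier (quantum_plane F q)"
      "g = qp_mult q ?f h + r" "g' = qp_mult q ?f h' + r'"
      "\<forall>i j. 1 < i \<longrightarrow> Poly_Mapping.lookup r (i, j) = 0"
      "\<forall>i j. 1 < i \<longrightarrow> Poly_Mapping.lookup r' (i, j) = 0" unfolding P_def by blast
    then show ?thesis unfolding P_def
      by (intro exI[of _ "h + h'"] exI[of _ "r + r'"])
         (auto simp: qp_mult_add_right lookup_add quantum_plane_def intro: cl)
  qed
  have low: "P g" if "\<forall>i j. 1 < i \<longrightarrow> Poly_Mapping.lookup g (i, j) = 0" for g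
    unfolding P_def using that cl(1) by (intro exI[of _ 0] exI[of _ g]) (auto simp: quantum_plane_def)
  have multiple: "P (qp_mult q ?f h)" if "h \<in> carrier (quantum_plane F q)" for h
    unfolding P_def using that by (intro exI[of _ h] exI[of _ 0]) auto
  have single: "P (Poly_Mapping.single (i, j) d)" if "d \<in> F" for i j d
    using that
  proof (induction i arbitrary: j d rule: less_induct)
    case (less i)
    show ?case
    proof (cases "i \<le> 1")
      case True
      then show ?thesis by (intro low) (auto simp: lookup_single when_def)
    next
      case False
      then obtain k where k: "i = k + 2" by (metis add.commute le_add_diff_inverse not_less_eq_eq one_add_one plus_1_eq_Suc)
      define e where "e = inverse a * d"
      have e: "e \<in> F" "a * e = d" using a less.prems coeffs by (auto simp: e_def intro: cl)
      have "Poly_Mapping.single (i, j) d = qp_mult q ?f (Poly_Mapping.single (k, j) e) +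
          (Poly_Mapping.single (k + 1, j + 1) (- (q ^ k * b * e)) + Poly_Mapping.single (k, j + 2) (- (q ^ (2 * k) * c * e)))"
        using e(2) by (simp add: quadratic_def qp_mult_add_left qp_mult_single k single_uminus add.commute)
      moreover have "P (qp_mult q ?f (Poly_Mapping.single (k, j) e))"
        using e(1) cl(1) by (intro multiple) (auto simp: quantum_plane_def lookup_single when_def)
      moreover have "P (Poly_Mapping.single (k + 1, j + 1) (- (q ^ k * b * e)))"
        "P (Poly_Mapping.single (k, j + 2) (- (q ^ (2 * k) * c * e)))"
        using e(1) coeffs pow by (auto simp: k intro!: less.IH cl)
      ultimately show ?thesis by (metis add)
    qed
  qed
  have "P (\<Sum>m\<in>A. Poly_Mapping.single m (Poly_Mapping.lookup g m))" if "finite A" for A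
    using that
  proof induction
    case empty
    show ?case by (rule low) simp
  next
    case (insert m A)
    have "P (Poly_Mapping.single m (Poly_Mapping.lookup g m))"
      using single g by (cases m) (auto simp: quantum_plane_def)
    with insert show ?case by (simp add: add)
  qed
  moreover have "g = (\<Sum>m\<in>Poly_Mapping.keys g. Poly_Mapping.single m (Poly_Mapping.lookup g m))"
    by (rule poly_mapping_eqI)
       (auto simp: lookup_sum lookup_single when_def not_in_keys_iff_lookup_eq_zero)
  ultimately have "P g" by (metis finite_keys)
  then show thesis using that unfolding P_def by blast
qed

text \<open>
  In degree \<open>n + 1\<close> the image of such a remainder is \<open>u + v\<zeta>\<close> with real \<open>u\<close> and \<open>v\<close>, and \<open>1\<close> and \<open>\<zeta>\<close> are
  linearly independent over the reals.
\<close>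

lemma skew_coeff_kernel_remainder:
  assumes low: "\<And>i j. 1 < i \<Longrightarrow> Poly_Mapping.lookup r (i, j) = 0"
    and \<zeta>: "Im \<zeta> \<noteq> 0" and zero: "\<And>n. skew_coeff q \<zeta> r n = 0"
  shows "r = 0"
proof -
  have 0: "Poly_Mapping.lookup r (0, 0) = 0"
    using zero[of 0] by (simp add: skew_coeff_def)
  have "Poly_Mapping.lookup r (0, Suc n) = 0 \<and> Poly_Mapping.lookup r (1, n) = 0" for n
  proof -
    have "skew_coeff q \<zeta> r (Suc n) =
        (\<Sum>i\<in>{0, 1}. complex_of_real (Poly_Mapping.lookup r (i, Suc n - i) * q ^ (i choose 2)) * \<zeta> ^ i)"
      unfolding skew_coeff_def by (intro sum.mono_neutral_right) (auto simp: low)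
    with zero[of "Suc n"]
    have *: "complex_of_real (Poly_Mapping.lookup r (0, Suc n)) + complex_of_real (Poly_Mapping.lookup r (1, n)) * \<zeta> = 0"
      by (simp add: numeral_2_eq_2)
    from arg_cong[OF *, of Im] \<zeta> have "Poly_Mapping.lookup r (1, n) = 0" by simp
    with * show ?thesis by simp
  qed
  note 1 = this
  show ?thesis
  proof (rule poly_mapping_eqI)
    fix m :: "nat \<times> nat"
    obtain i j where m: "m = (i, j)" by fastforce
    have "i = 0 \<and> j = 0 \<or> i = 0 \<and> (\<exists>j'. j = Suc j') \<or> i = 1 \<or> 1 < i"
      by (cases j) auto
    then consider "i = 0" "j = 0" | j' where "i = 0" "j = Suc j'" | "i = 1" | "1 < i"
      by blast
    then show "Poly_Mapping.lookup r m = Poly_Mapping.lookup 0 m"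
      by cases (use 0 1 low m in auto)
  qed
qed

text \<open>
  Left and right multiples of the form both lie in the kernel, and every element of the kernel is a
  right multiple.  The two sides of divisibility therefore agree for this form, and primality says
  that the kernel is a completely prime ideal.
\<close>

lemma (in skew_specialization) prime_lr_quadratic:
  fixes F :: "real set"
  assumes F: "subfield F (ring_of_type_algebra :: real ring)" and q: "q \<in> F"
    and coeffs: "a \<in> F" "b \<in> F" "c \<in> F" and a: "a \<noteq> 0" and \<zeta>: "Im \<zeta> \<noteq> 0"
    and root: "complex_of_real (a * q) * \<zeta>\<^sup>2 + complex_of_real b * \<zeta> + complex_of_real c = 0"
  shows "prime_lr (quantum_plane F q) (quadratic a b c)"
proof -
  let ?R = "quantum_plane F q" and ?f = "quadratic a b c"
  have f: "skew_coeff q \<zeta> ?f n = 0" for n by (rule skew_coeff_quadratic[OF root])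
  have divides: "divides_lr ?R ?f g" if g: "g \<in> carrier ?R" and zero: "\<And>n. skew_coeff q \<zeta> g n = 0" for g
  proof -
    obtain h r where hr: "h \<in> carrier ?R" "g = qp_mult q ?f h + r"
      "\<And>i j. 1 < i \<Longrightarrow> Poly_Mapping.lookup r (i, j) = 0"
      using x_degree_le_1_division[OF F q coeffs a g] by metis
    have "skew_coeff q \<zeta> r n = 0" for n
      using zero[of n] by (simp add: hr(2) skew_coeff_add skew_coeff_mult f)
    with hr(3) \<zeta> have "r = 0" by (rule skew_coeff_kernel_remainder)
    with hr show ?thesis by (auto simp: divides_lr_def quantum_plane_def)
  qed
  have "?f \<in> carrier ?R"
    using coeffs subfield_type_algebraD(1)[OF F]
    by (auto simp: quantum_plane_def lookup_quadratic)
  moreover have "divides_lr ?R ?f s \<or> divides_lr ?R ?f t"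
    if "s \<in> carrier ?R" "t \<in> carrier ?R" "divides_lr ?R ?f (s \<otimes>\<^bsub>?R\<^esub> t)" for s t
  proof -
    from that(3) obtain u where "qp_mult q s t = qp_mult q ?f u \<or> qp_mult q s t = qp_mult q u ?f"
      by (auto simp: divides_lr_def quantum_plane_def)
    moreover have "skew_coeff q \<zeta> (qp_mult q ?f u) n = 0" "skew_coeff q \<zeta> (qp_mult q u ?f) n = 0" for n
      unfolding skew_coeff_mult f by (simp_all add: iterate_0)
    ultimately have "skew_coeff q \<zeta> (qp_mult q s t) n = 0" for n by metis
    then show ?thesis using skew_coeff_mult_nonzero divides that by metis
  qed
  ultimately show ?thesis by (simp add: prime_lr_def)
qed

section \<open>Classification\<close>

text \<open>
  The real part is recorded because conjugation sends a nonreal \<open>\<zeta>\<close> to \<open>-\<zeta>\<close> exactly when it vanishes.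
\<close>

lemma complex_root_of_negative_discriminant:
  fixes A b c :: real
  assumes "b\<^sup>2 - 4 * A * c < 0"
  obtains \<zeta> where "Re \<zeta> = - b / (2 * A)" "Im \<zeta> \<noteq> 0"
    "complex_of_real A * \<zeta>\<^sup>2 + complex_of_real b * \<zeta> + complex_of_real c = 0"
proof -
  define s where "s = sqrt (4 * A * c - b\<^sup>2)"
  have s: "s \<noteq> 0" "s * s = 4 * A * c - b * b" using assms by (simp_all add: s_def power2_eq_square)
  have A: "A \<noteq> 0" using assms by (auto simp: not_less)
  define \<zeta> where "\<zeta> = Complex (- b / (2 * A)) (s / (2 * A))"
  have "complex_of_real A * \<zeta>\<^sup>2 + complex_of_real b * \<zeta> + complex_of_real c = 0"
    using A by (simp add: \<zeta>_def complex_eq_iff power2_eq_square field_simps s(2))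
  moreover have "Im \<zeta> \<noteq> 0" "Re \<zeta> = - b / (2 * A)" using A s(1) by (simp_all add: \<zeta>_def)
  ultimately show thesis using that by blast
qed

theorem theorem14:
  fixes F :: "real set" and q a b c :: real
  assumes "subfield F (ring_of_type_algebra :: real ring)"
    and "q \<in> F - {0}"
    and "a \<in> F" and "b \<in> F" and "c \<in> F"
    and "b\<^sup>2 - 4 * a * c * q < 0"
  shows "qp_irreducible F q (qp_quadratic_form F q a b c) \<and>
    (q \<noteq> 1 \<and> q \<noteq> - 1 \<longrightarrow> \<not> prime_lr (quantum_plane F q) (qp_quadratic_form F q a b c)) \<and>
    (q = 1 \<longrightarrow> prime_lr (quantum_plane F q) (qp_quadratic_form F q a b c)) \<and>
    (q = - 1 \<longrightarrow> (prime_lr (quantum_plane F q) (qp_quadratic_form F q a b c) \<longleftrightarrow> b = 0))"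
proof -
  let ?prime = "prime_lr (quantum_plane F q) (quadratic a b c)"
  note F = assms(1) and coeffs = assms(3-5) and disc = assms(6)
  have q: "q \<in> F" "q \<noteq> 0" using assms(2) by auto
  have ac: "a \<noteq> 0" "c \<noteq> 0" using disc by (auto simp: not_less)
  have irr: "qp_irreducible F q (quadratic a b c)"
    using subfield_type_algebraD(1)[OF F] q(2) coeffs disc by (rule qp_irreducible_quadratic)
  have not_prime: "\<not> ?prime" if "b / q \<noteq> b \<or> c / q\<^sup>2 \<noteq> c"
    using F q coeffs ac(1) that by (rule not_prime_lr_quadratic)
  have generic: "\<not> ?prime" if "q \<noteq> 1" "q \<noteq> - 1"
  proof -
    have "q\<^sup>2 \<noteq> 1" using that by (simp add: power2_eq_1_iff)
    then show ?thesis using ac(2) q(2) by (intro not_prime) (simp add: field_simps)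
  qed
  have "b\<^sup>2 - 4 * (a * q) * c < 0" using disc by (simp add: mult_ac)
  then obtain \<zeta> where \<zeta>: "Re \<zeta> = - b / (2 * (a * q))" "Im \<zeta> \<noteq> 0"
    "complex_of_real (a * q) * \<zeta>\<^sup>2 + complex_of_real b * \<zeta> + complex_of_real c = 0"
    by (rule complex_root_of_negative_discriminant)
  have commutative: "?prime" if "q = 1"
  proof -
    interpret skew_specialization q \<zeta> "\<lambda>z. z"
      by unfold_locales (simp_all add: that)
    show ?thesis by (rule prime_lr_quadratic[OF F q(1) coeffs ac(1) \<zeta>(2,3)])
  qed
  have anticommutative: "?prime" if "q = - 1" "b = 0"
  proof -
    interpret skew_specialization q \<zeta> cnj
      using \<zeta>(1) by unfold_locales (simp_all add: that complex_eq_iff)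
    show ?thesis by (rule prime_lr_quadratic[OF F q(1) coeffs ac(1) \<zeta>(2,3)])
  qed
  have "b = 0" if "q = - 1" "?prime"
    using not_prime that by auto
  then show ?thesis
    unfolding qp_quadratic_form_eq quadratic_def[symmetric]
    using irr generic commutative anticommutative by blast
qed

end
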